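(* Let $\mathbb{X}$ be a reflexive, Kadets-Klee real Banach space and let $\mathbb{Y}$ be a smooth real Banach space such that $\dim(\mathbb{Y})>1$. Let $T\in\mathbb{K}(\mathbb{X},\mathbb{Y})$ be such that $\|T\|=1$. Then $T$ is smooth if and only if for every $\epsilon>0$, $T$ admits a non-trivial uniform $\epsilon$-BPB approximation which is also smooth.
   Context: $\mathbb{L}(\mathbb{X},\mathbb{Y})$ (resp. $\mathbb{K}(\mathbb{X},\mathbb{Y})$) is the space of bounded (resp. compact) linear operators with the operator norm; $S_Z$ is the unit sphere of a normed space $Z$. $\mathbb{X}$ is Kadets-Klee if $x_n\to x$ weakly and $\|x_n\|\to\|x\|$ imply $x_n\to x$ in norm. A non-zero element $z$ of a normed space $Z$ is smooth if there is exactly one $f\in S_{Z^*}$ with $f(z)=\|z\|$; a Banach space is smooth if each of its non-zero vectors is smooth. An operator is called smooth if it is a smooth element of the normed space $\mathbb{L}(\mathbb{X},\mathbb{Y})$. For $A\in\mathbb{L}(\mathbb{X},\mathbb{Y})$, $M_A=\{x\in S_{\mathbb{X}}:\|Ax\|=\|A\|\}$. For $T\in S_{\mathbb{L}(\mathbb{X},\mathbb{Y})}$ and $\epsilon>0$, an operator $A\in S_{\mathbb{L}(\mathbb{X},\mathbb{Y})}$ is a uniform $\epsilon$-BPB approximation of $T$ if $\|T-A\|<\epsilon$ and there exists $\delta(\epsilon)>0$ such that for each $x_0\in S_{\mathbb{X}}$ with $\|Tx_0\|>1-\delta(\epsilon)$ there exists $u_0\in M_A$ with $\|u_0-x_0\|<\epsilon$.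 It is non-trivial if in addition $A\neq T$. *)

theory Defs
  imports "HOL-Analysis.Analysis"
begin

text \<open>
  All spaces are real. \<open>'a \<Rightarrow>\<^sub>L 'b\<close> carries the operator norm, and \<open>'a \<Rightarrow>\<^sub>L real\<close> is the
  (topological) dual of \<open>'a\<close>.
\<close>

definition bidual_embedding :: "'a::real_normed_vector \<Rightarrow> (('a \<Rightarrow>\<^sub>L real) \<Rightarrow>\<^sub>L real)" where
  "bidual_embedding x = Blinfun (\<lambda>f. blinfun_apply f x)"

lemma bidual_embedding_apply [simp]:
  "blinfun_apply (bidual_embedding x) f = blinfun_apply f x"
  unfolding bidual_embedding_def
  by (simp add: bounded_linear_Blinfun_apply blinfun.bounded_linear_left)

definition reflexive_space :: "'a::real_normed_vector itself \<Rightarrow> bool" where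
  "reflexive_space _ \<longleftrightarrow> surj (bidual_embedding :: 'a \<Rightarrow> (('a \<Rightarrow>\<^sub>L real) \<Rightarrow>\<^sub>L real))"

definition weakly_converges :: "(nat \<Rightarrow> 'a::real_normed_vector) \<Rightarrow> 'a \<Rightarrow> bool" where
  "weakly_converges x l \<longleftrightarrow>
     (\<forall>f :: 'a \<Rightarrow>\<^sub>L real. (\<lambda>n. blinfun_apply f (x n)) \<longlonglongrightarrow> blinfun_apply f l)"

definition kadets_klee :: "'a::real_normed_vector itself \<Rightarrow> bool" where
  "kadets_klee _ \<longleftrightarrow>
     (\<forall>(x :: nat \<Rightarrow> 'a) l.
        weakly_converges x l \<longrightarrow> (\<lambda>n. norm (x n)) \<longlonglongrightarrow> norm l \<longrightarrow> x \<longlonglongrightarrow> l)"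

definition smooth_element :: "'a::real_normed_vector \<Rightarrow> bool" where
  "smooth_element z \<longleftrightarrow>
     z \<noteq> 0 \<and> (\<exists>!f :: 'a \<Rightarrow>\<^sub>L real. norm f = 1 \<and> blinfun_apply f z = norm z)"

definition smooth_space :: "'a::real_normed_vector itself \<Rightarrow> bool" where
  "smooth_space _ \<longleftrightarrow> (\<forall>z :: 'a. z \<noteq> 0 \<longrightarrow> smooth_element z)"

text \<open>
  The library constant \<open>dim\<close> is \<open>0\<close> on infinite-dimensional spaces, so \<open>dim > 1\<close> is expressed
  through a Hamel basis, which may be infinite.
\<close>

definition dim_greater_one :: "'a::real_vector itself \<Rightarrow> bool" where
  "dim_greater_one _ \<longleftrightarrow>
     (\<exists>B :: 'a set. independent B \<and> span B = UNIV \<and> (infinite B \<or> card B > 1))"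

definition compact_operator :: "('a::real_normed_vector \<Rightarrow>\<^sub>L 'b::real_normed_vector) \<Rightarrow> bool" where
  "compact_operator T \<longleftrightarrow> compact (closure (blinfun_apply T ` cball 0 1))"

definition norm_attainment_set ::
    "('a::real_normed_vector \<Rightarrow>\<^sub>L 'b::real_normed_vector) \<Rightarrow> 'a set" where
  "norm_attainment_set A = {x. norm x = 1 \<and> norm (blinfun_apply A x) = norm A}"

definition uniform_BPB_approximation ::
    "real \<Rightarrow> ('a::real_normed_vector \<Rightarrow>\<^sub>L 'b::real_normed_vector) \<Rightarrow> ('a \<Rightarrow>\<^sub>L 'b) \<Rightarrow> bool" where
  "uniform_BPB_approximation \<epsilon> T A \<longleftrightarrow>
     norm T = 1 \<and> norm A = 1 \<and> norm (T - A) < \<epsilon> \<and>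
     (\<exists>\<delta>>0. \<forall>x0. norm x0 = 1 \<longrightarrow> norm (blinfun_apply T x0) > 1 - \<delta> \<longrightarrow>
        (\<exists>u0 \<in> norm_attainment_set A. norm (u0 - x0) < \<epsilon>))"

definition nontrivial_uniform_BPB_approximation ::
    "real \<Rightarrow> ('a::real_normed_vector \<Rightarrow>\<^sub>L 'b::real_normed_vector) \<Rightarrow> ('a \<Rightarrow>\<^sub>L 'b) \<Rightarrow> bool" where
  "nontrivial_uniform_BPB_approximation \<epsilon> T A \<longleftrightarrow> uniform_BPB_approximation \<epsilon> T A \<and> A \<noteq> T"

end

theory Submission
  imports Defs "HOL-Library.Diagonal_Subsequence"
begin

text \<open>
  Say that \<open>A\<close> attains its norm strongly at \<open>x0\<close> if unit vectors that almost attain it are near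
  \<open>\<plusminus>x0\<close>. Such an operator is smooth when \<open>A x0\<close> is, because \<open>\<parallel>A + t S\<parallel> \<le> 1 + o(t)\<close> whenever the
  support functional at \<open>A x0\<close> kills \<open>S x0\<close>; conversely a smooth operator attains its norm at most
  at one pair \<open>\<plusminus>u\<close>. For compact \<open>T\<close>, weak sequential compactness and the Kadets--Klee property give
  strong attainment as soon as \<open>M\<^sub>T = {\<plusminus>x0}\<close>.

  If \<open>T\<close> is smooth, \<open>A = (1 - t) T + t f(\<cdot>) T x0\<close> with \<open>f\<close> a support functional at \<open>x0\<close> attains its
  norm strongly at the same \<open>x0\<close>; when this is \<open>T\<close> itself, take \<open>A = f(\<cdot>) z\<close> with a unit vector
  \<open>z \<noteq> T x0\<close> near \<open>T x0\<close>. Conversely, smooth uniform approximations force every point of \<open>M\<^sub>T\<close> to be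
  within \<open>\<epsilon>\<close> of a single pair \<open>\<plusminus>u\<close>, for every \<open>\<epsilon>\<close>.
\<close>

section \<open>Sublinear functionals and the Hahn--Banach theorem\<close>

text \<open>Homogeneity is asked as an inequality only: applying it to \<open>1/c\<close> as well
  yields equality, and infima then need one estimate instead of two.\<close>

definition sublinear :: "('a::real_vector \<Rightarrow> real) \<Rightarrow> bool" where
  "sublinear p \<longleftrightarrow>
     (\<forall>x y. p (x + y) \<le> p x + p y) \<and> (\<forall>c>0. \<forall>x. p (c *\<^sub>R x) \<le> c * p x)"

lemma sublinear_add: "sublinear p \<Longrightarrow> p (x + y) \<le> p x + p y"
  by (simp add: sublinear_def)

lemma sublinear_scaleR_le: "sublinear p \<Longrightarrow> c > 0 \<Longrightarrow> p (c *\<^sub>R x) \<le> c * p x"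
  by (simp add: sublinear_def)

lemma sublinear_zero:
  assumes "sublinear p"
  shows "p 0 = 0"
  \<comment> \<open>The factor \<open>1/2\<close> gives \<open>p 0 \<le> 0\<close>, the factor
    \<open>2\<close> gives \<open>0 \<le> p 0\<close>.\<close>
  using sublinear_scaleR_le[OF assms, of "1/2" 0] sublinear_scaleR_le[OF assms, of 2 0] by simp

lemma sublinear_scaleR:
  assumes "sublinear p" "c > 0"
  shows "p (c *\<^sub>R x) = c * p x"
proof (rule antisym)
  show "p (c *\<^sub>R x) \<le> c * p x"
    using assms by (rule sublinear_scaleR_le)
  have "p ((1/c) *\<^sub>R (c *\<^sub>R x)) \<le> (1/c) * p (c *\<^sub>R x)"
    using assms by (intro sublinear_scaleR_le) auto
  then show "c * p x \<le> p (c *\<^sub>R x)"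
    using assms by (simp add: field_simps)
qed

lemma sublinear_minus:
  assumes "sublinear p"
  shows "- p (- x) \<le> p x"
  using sublinear_add[OF assms, of x "- x"] sublinear_zero[OF assms] by simp

lemma sublinear_norm: "sublinear norm"
  by (auto simp: sublinear_def norm_triangle_ineq)

text \<open>Common source of the sublinear functionals below: one-sided derivatives, infima of
  chains, distances to a subspace and upper limits. \<open>R x s\<close> reads "\<open>s\<close> is
  an admissible upper value at \<open>x\<close>"; the bound \<open>b\<close> keeps each infimum
  finite.\<close>

lemma sublinear_Inf:
  fixes R :: "'a::real_vector \<Rightarrow> real \<Rightarrow> bool"
  assumes ne: "\<And>x. \<exists>s. R x s"
    and below: "\<And>x s. R x s \<Longrightarrow> b x \<le> s"
    and add: "\<And>x y s t. R x s \<Longrightarrow> R y t \<Longrightarrow> R (x + y) (s + t)"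
    and scale: "\<And>c x s. c > 0 \<Longrightarrow> R x s \<Longrightarrow> R (c *\<^sub>R x) (c * s)"
  shows "sublinear (\<lambda>x. Inf {s. R x s})"
proof -
  have lower: "Inf {s. R x s} \<le> s" if "R x s" for x s
    using that below by (intro cInf_lower bdd_belowI[of _ "b x"]) auto
  have approx: "\<exists>s. R x s \<and> s < Inf {s. R x s} + e" if "e > 0" for x e
    using cInf_lessD[of "{s. R x s}" "Inf {s. R x s} + e"] ne[of x] that by auto
  show ?thesis
    unfolding sublinear_def
  proof (intro conjI allI impI)
    fix x y
    show "Inf {s. R (x + y) s} \<le> Inf {s. R x s} + Inf {s. R y s}"
    proof (rule field_le_epsilon)
      fix e :: real assume "e > 0"
      then obtain s t where "R x s" "s < Inf {s. R x s} + e/2" "R y t" "t < Inf {s. R y s} + e/2"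
        using approx[of "e/2"] by (metis half_gt_zero)
      then show "Inf {s. R (x + y) s} \<le> Inf {s. R x s} + Inf {s. R y s} + e"
        using lower[OF add, of x s y t] by simp
    qed
  next
    fix c :: real and x assume c: "c > 0"
    have "Inf {s. R (c *\<^sub>R x) s} / c \<le> Inf {s. R x s}"
    proof (rule field_le_epsilon)
      fix e :: real assume "e > 0"
      then obtain s where s: "R x s" "s < Inf {s. R x s} + e"
        using approx by metis
      have "Inf {s. R (c *\<^sub>R x) s} / c \<le> s"
        using lower[OF scale[OF c s(1)]] c by (simp add: field_simps)
      then show "Inf {s. R (c *\<^sub>R x) s} / c \<le> Inf {s. R x s} + e"
        using s by simp
    qed
    then show "Inf {s. R (c *\<^sub>R x) s} \<le> c * Inf {s. R x s}"
      using c by (simp add: field_simps)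
  qed
qed

section \<open>One-sided directional derivatives of sublinear functionals\<close>

text \<open>
  The values do not increase with \<open>t\<close>; for \<open>p = norm\<close> the infimum is the right derivative of the
  norm at \<open>a\<close> in direction \<open>x\<close>.
\<close>

definition directional :: "('a::real_vector \<Rightarrow> real) \<Rightarrow> 'a \<Rightarrow> 'a \<Rightarrow> real" where
  "directional p a x = Inf {s. \<exists>t\<ge>0. p (x + t *\<^sub>R a) - t * p a \<le> s}"

lemma directional_bound:
  assumes p: "sublinear p" and "t \<ge> 0"
  shows "- p (- x) \<le> p (x + t *\<^sub>R a) - t * p a"
proof -
  have "t * p a = p (t *\<^sub>R a)"
    using assms sublinear_scaleR[OF p, of t a] sublinear_zero[OF p] by (cases "t = 0") auto
  also have "\<dots> \<le> p (x + t *\<^sub>R a) + p (- x)"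
    using sublinear_add[OF p, of "x + t *\<^sub>R a" "- x"] by simp
  finally show ?thesis by simp
qed

lemma directional_le:
  assumes "sublinear p" "t \<ge> 0"
  shows "directional p a x \<le> p (x + t *\<^sub>R a) - t * p a"
  unfolding directional_def
proof (rule cInf_lower)
  show "bdd_below {s. \<exists>t\<ge>0. p (x + t *\<^sub>R a) - t * p a \<le> s}"
    using directional_bound[OF assms(1)] order_trans
    by (intro bdd_belowI[of _ "- p (- x)"]) blast
qed (use assms in auto)

lemma directional_le_self: "sublinear p \<Longrightarrow> directional p a x \<le> p x"
  using directional_le[of p 0 a x] by simp

text \<open>The choice \<open>t = 1\<close> cancels the argument. This bound forces every linear
  functional below \<open>directional p a\<close> to agree with \<open>p\<close> at
  \<open>a\<close>.\<close>

lemma directional_minus: "sublinear p \<Longrightarrow> directional p a (- a) \<le> - p a"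
  using directional_le[of p 1 a "- a"] sublinear_zero[of p] by simp

lemma directional_lessD:
  assumes "directional p a x < s"
  shows "\<exists>t\<ge>0. p (x + t *\<^sub>R a) - t * p a < s"
proof -
  have "{s. \<exists>t\<ge>0. p (x + t *\<^sub>R a) - t * p a \<le> s} \<noteq> {}"
    by auto
  from cInf_lessD[OF this, of s] show ?thesis
    using assms unfolding directional_def by force
qed

text \<open>Witnesses \<open>t\<close> and \<open>u\<close> for two vectors add up to a witness for
  the sum, and scaling a vector by \<open>c\<close> scales its witness by \<open>c\<close>.\<close>

lemma sublinear_directional:
  assumes p: "sublinear p"
  shows "sublinear (directional p a)"
proof -
  have "sublinear (\<lambda>x. Inf {s. \<exists>t\<ge>0. p (x + t *\<^sub>R a) - t * p a \<le> s})"
  proof (rule sublinear_Inf[where b = "\<lambda>x. - p (- x)"])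
    fix x s assume "\<exists>t\<ge>0. p (x + t *\<^sub>R a) - t * p a \<le> s"
    then show "- p (- x) \<le> s"
      using directional_bound[OF p] order_trans by blast
  next
    fix x y s1 s2
    assume "\<exists>t\<ge>0. p (x + t *\<^sub>R a) - t * p a \<le> s1" "\<exists>t\<ge>0. p (y + t *\<^sub>R a) - t * p a \<le> s2"
    then obtain t u where tu: "t \<ge> 0" "p (x + t *\<^sub>R a) - t * p a \<le> s1"
      "u \<ge> 0" "p (y + u *\<^sub>R a) - u * p a \<le> s2" by auto
    then have "p ((x + y) + (t + u) *\<^sub>R a) - (t + u) * p a \<le> s1 + s2"
      using sublinear_add[OF p, of "x + t *\<^sub>R a" "y + u *\<^sub>R a"] by (simp add: algebra_simps)
    then show "\<exists>t\<ge>0. p ((x + y) + t *\<^sub>R a) - t * p a \<le> s1 + s2"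
      using tu by (intro exI[of _ "t + u"]) auto
  next
    fix c :: real and x s
    assume c: "c > 0" and "\<exists>t\<ge>0. p (x + t *\<^sub>R a) - t * p a \<le> s"
    then obtain t where t: "t \<ge> 0" "p (x + t *\<^sub>R a) - t * p a \<le> s" by auto
    have "p (c *\<^sub>R (x + t *\<^sub>R a)) \<le> c * p (x + t *\<^sub>R a)"
      using p c by (rule sublinear_scaleR_le)
    also have "\<dots> \<le> c * (s + t * p a)"
      using t c by simp
    finally show "\<exists>t\<ge>0. p (c *\<^sub>R x + t *\<^sub>R a) - t * p a \<le> c * s"
      using t c by (intro exI[of _ "c * t"]) (auto simp: algebra_simps)
  qed auto
  then show ?thesis
    by (simp add: directional_def[abs_def])
qed

section \<open>Minimal sublinear functionals and the Hahn--Banach theorem\<close>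

text \<open>Zorn's lemma on the sublinear minorants of \<open>p\<close>. The pointwise infimum of a
  chain is finite, since every member is at least \<open>- p (- x)\<close> at \<open>x\<close>, and
  it is again sublinear.\<close>

lemma minimal_sublinear_below:
  fixes p :: "'a::real_vector \<Rightarrow> real"
  assumes p: "sublinear p"
  obtains m where "sublinear m" "\<And>x. m x \<le> p x"
    "\<And>q. sublinear q \<Longrightarrow> (\<And>x. q x \<le> m x) \<Longrightarrow> q = m"
proof -
  define A where "A = {q. sublinear q \<and> (\<forall>x. q x \<le> p x)}"
  \<comment> \<open>The order is reversed, so that a maximal element for \<open>P\<close> is a
    minimal functional.\<close>
  define P :: "('a \<Rightarrow> real) \<Rightarrow> ('a \<Rightarrow> real) \<Rightarrow> bool" where "P = (\<lambda>f g. \<forall>x. g x \<le> f x)"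
  have "\<exists>m\<in>A. \<forall>a\<in>A. P m a \<longrightarrow> a = m"
  proof (rule predicate_Zorn)
    show "partial_order_on A (relation_of P A)"
      by (rule partial_order_on_relation_ofI) (auto simp: P_def fun_eq_iff intro: order_trans order_antisym)
  next
    fix C assume C: "C \<in> Chains (relation_of P A)"
    then have CA: "C \<subseteq> A"
      by (auto simp: Chains_def relation_of_def)
    show "\<exists>u\<in>A. \<forall>a\<in>C. P a u"
    proof (cases "C = {}")
      case True
      then show ?thesis using p by (auto simp: A_def)
    next
      case False
      define u where "u = (\<lambda>x. Inf {s. \<exists>q\<in>C. q x \<le> s})"
      have below: "- p (- x) \<le> s" if "\<exists>q\<in>C. q x \<le> s" for x s
      proof -
        from that obtain q where q: "sublinear q" "q (- x) \<le> p (- x)" "q x \<le> s"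
          using CA by (auto simp: A_def)
        then show ?thesis using sublinear_minus[of q x] by simp
      qed
      have "sublinear u"
        unfolding u_def
      proof (rule sublinear_Inf[where b = "\<lambda>x. - p (- x)"])
        fix x y s t assume "\<exists>q\<in>C. q x \<le> s" "\<exists>q\<in>C. q y \<le> t"
        then obtain q r where qr: "q \<in> C" "q x \<le> s" "r \<in> C" "r y \<le> t" by auto
        \<comment> \<open>The smaller of the two chain members serves at both points, which gives
          subadditivity of the infimum.\<close>
        then have "P q r \<or> P r q"
          using C by (auto simp: Chains_def relation_of_def)
        then obtain k where k: "k \<in> C" "k x \<le> s" "k y \<le> t"
          using qr by (auto simp: P_def intro: order_trans)
        then have "k (x + y) \<le> s + t"
          using CA sublinear_add[of k x y] by (force simp: A_def)
        with k show "\<exists>q\<in>C. q (x + y) \<le> s + t" by auto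
      next
        fix c :: real and x s assume c: "c > 0" and "\<exists>q\<in>C. q x \<le> s"
        then obtain q where q: "q \<in> C" "q x \<le> s" by auto
        then have "q (c *\<^sub>R x) \<le> c * q x"
          using CA c sublinear_scaleR_le[of q c x] by (auto simp: A_def)
        also have "\<dots> \<le> c * s"
          using q c by simp
        finally show "\<exists>q\<in>C. q (c *\<^sub>R x) \<le> c * s"
          using q by auto
      qed (use False below in auto)
      moreover have le: "u x \<le> q x" if "q \<in> C" for q x
        unfolding u_def using that below
        by (intro cInf_lower bdd_belowI[of _ "- p (- x)"]) auto
      moreover have "u x \<le> p x" for x
        using False le CA order_trans unfolding A_def by blast
      ultimately show ?thesis
        by (intro bexI[of _ u]) (auto simp: A_def P_def)
    qed
  qed
  then obtain m where m: "m \<in> A" "\<And>a. a \<in> A \<Longrightarrow> P m a \<Longrightarrow> a = m"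
    by blast
  show thesis
  proof (rule that)
    fix q assume "sublinear q" "\<And>x. q x \<le> m x"
    then show "q = m"
      using m unfolding A_def P_def by (smt (verit) mem_Collect_eq)
  qed (use m in \<open>auto simp: A_def\<close>)
qed

text \<open>\<open>directional m a\<close> is sublinear and below \<open>m\<close>, hence equal to
  \<open>m\<close>; its defining bound at \<open>t = 1\<close> then says that \<open>m\<close> is
  superadditive.\<close>

lemma linear_if_minimal_sublinear:
  assumes m: "sublinear m"
    and minimal: "\<And>q. sublinear q \<Longrightarrow> (\<And>x. q x \<le> m x) \<Longrightarrow> q = m"
  shows "linear m"
proof -
  have "m x + m a \<le> m (x + a)" for x a
    using directional_le[OF m, of 1 a x] minimal[OF sublinear_directional[OF m, of a]]
      directional_le_self[OF m] by simp
  then have add: "m (x + a) = m x + m a" for x a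
    using sublinear_add[OF m, of x a] by (intro antisym)
  have minus: "m (- x) = - m x" for x
    using add[of x "- x"] sublinear_zero[OF m] by simp
  have "m (c *\<^sub>R x) = c * m x" for c x
  proof (cases c "0 :: real" rule: linorder_cases)
    case less
    then show ?thesis
      using sublinear_scaleR[OF m, of "- c" x] minus[of "c *\<^sub>R x"] by simp
  qed (use sublinear_zero[OF m] sublinear_scaleR[OF m] in auto)
  with add show ?thesis
    by (intro linearI) auto
qed

theorem hahn_banach_sublinear:
  assumes p: "sublinear p"
  obtains h where "linear h" "\<And>x. h x \<le> p x" "h a = p a"
proof -
  \<comment> \<open>Minimality is taken below \<open>directional p a\<close> rather than
    \<open>p\<close>; this is what secures the value \<open>p a\<close> at \<open>a\<close>.\<close>
  obtain m where m: "sublinear m" "\<And>x. m x \<le> directional p a x"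
    "\<And>q. sublinear q \<Longrightarrow> (\<And>x. q x \<le> m x) \<Longrightarrow> q = m"
    using minimal_sublinear_below[OF sublinear_directional[OF p]] by metis
  have lin: "linear m"
    using m(1,3) by (rule linear_if_minimal_sublinear)
  have le: "m x \<le> p x" for x
    using m(2)[of x] directional_le_self[OF p, of a x] by simp
  have "m (- a) \<le> - p a"
    using m(2)[of "- a"] directional_minus[OF p, of a] by simp
  then have "m a = p a"
    using le[of a] linear_neg[OF lin, of a] by simp
  with lin le show thesis
    by (rule that)
qed

theorem hahn_banach_bounded:
  fixes p :: "'a::real_normed_vector \<Rightarrow> real"
  assumes p: "sublinear p" and bound: "\<And>x. p x \<le> K * norm x"
  obtains h :: "'a \<Rightarrow>\<^sub>L real" where "\<And>x. h x \<le> p x" "h a = p a"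
proof -
  obtain h where h: "linear h" "\<And>x. h x \<le> p x" "h a = p a"
    using hahn_banach_sublinear[OF p] by metis
  have le: "h x \<le> K * norm x" for x
    using h(2)[of x] bound[of x] by simp
  have "norm (h x) \<le> norm x * K" for x
    using le[of x] le[of "- x"] linear_neg[OF h(1), of x] by (simp add: mult.commute)
  then have "bounded_linear h"
    using h(1) by (intro bounded_linear_intro[of h K]) (auto simp: linear_add linear_scale)
  then have "blinfun_apply (Blinfun h) = h"
    by (rule bounded_linear_Blinfun_apply)
  with h show thesis
    by (intro that[of "Blinfun h"]) auto
qed

section \<open>Norming and separating functionals\<close>

lemma norm_blinfun_le_one:
  fixes h :: "'a::real_normed_vector \<Rightarrow>\<^sub>L real"
  assumes "\<And>x. h x \<le> norm x"
  shows "norm h \<le> 1"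
proof (rule norm_blinfun_bound)
  fix x
  show "norm (h x) \<le> 1 * norm x"
    using assms[of x] assms[of "- x"] by (simp add: blinfun.minus_right abs_le_iff)
qed simp

lemma blinfun_real_le:
  fixes h :: "'a::real_normed_vector \<Rightarrow>\<^sub>L real"
  shows "h x \<le> norm h * norm x"
  using norm_blinfun[of h x] by simp

lemma norm_blinfun_eq_one:
  fixes h :: "'a::real_normed_vector \<Rightarrow>\<^sub>L real"
  assumes "\<And>x. h x \<le> norm x" "h a = norm a" "a \<noteq> 0"
  shows "norm h = 1"
proof (rule antisym)
  show "norm h \<le> 1"
    using assms(1) by (rule norm_blinfun_le_one)
  show "1 \<le> norm h"
    using blinfun_real_le[of h a] assms(2,3) by simp
qed

lemma support_functional:
  fixes a :: "'a::real_normed_vector"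
  obtains h :: "'a \<Rightarrow>\<^sub>L real" where "\<And>x. h x \<le> norm x" "h a = norm a"
  using hahn_banach_bounded[where p = norm and K = 1 and a = a, OF sublinear_norm] by auto

lemma blinfun_real_eqI:
  fixes x y :: "'a::real_normed_vector"
  assumes "\<And>h :: 'a \<Rightarrow>\<^sub>L real. h x = h y"
  shows "x = y"
proof -
  obtain h :: "'a \<Rightarrow>\<^sub>L real" where "h (x - y) = norm (x - y)"
    using support_functional by metis
  with assms[of h] show ?thesis
    by (simp add: blinfun.diff_right)
qed

text \<open>Hahn--Banach for the distance \<open>p\<close> to \<open>E\<close>. A functional below
  \<open>p\<close> vanishes on \<open>E\<close>, because \<open>p \<le> 0\<close> there and
  \<open>E = - E\<close>; at \<open>a\<close> it takes the distance, which is positive as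
  \<open>E\<close> is closed.\<close>

lemma separation_closed_subspace:
  fixes E :: "'a::real_normed_vector set"
  assumes E: "subspace E" "closed E" and a: "a \<notin> E"
  obtains h :: "'a \<Rightarrow>\<^sub>L real" where "\<And>e. e \<in> E \<Longrightarrow> h e = 0" "h a \<noteq> 0"
proof -
  define p where "p = (\<lambda>x. Inf {s. \<exists>e\<in>E. norm (x - e) \<le> s})"
  have "0 \<in> E"
    using E(1) by (rule subspace_0)
  have sub: "sublinear p"
    unfolding p_def
  proof (rule sublinear_Inf[where b = "\<lambda>_. 0"])
    show "\<exists>s. \<exists>e\<in>E. norm (x - e) \<le> s" for x
      using \<open>0 \<in> E\<close> by blast
    show "0 \<le> s" if "\<exists>e\<in>E. norm (x - e) \<le> s" for x s
      using that by (auto intro: order_trans[OF norm_ge_zero])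
  next
    fix x y s t assume "\<exists>e\<in>E. norm (x - e) \<le> s" "\<exists>e\<in>E. norm (y - e) \<le> t"
    then obtain d e where "d \<in> E" "norm (x - d) \<le> s" "e \<in> E" "norm (y - e) \<le> t" by auto
    then show "\<exists>e\<in>E. norm (x + y - e) \<le> s + t"
      using subspace_add[OF E(1)]
      by (intro bexI[of _ "d + e"]) (auto intro: order_trans[OF norm_diff_triangle_ineq])
  next
    fix c :: real and x s assume "c > 0" "\<exists>e\<in>E. norm (x - e) \<le> s"
    then obtain e where e: "e \<in> E" "norm (x - e) \<le> s" by auto
    have "norm (c *\<^sub>R x - c *\<^sub>R e) = c * norm (x - e)"
      using \<open>c > 0\<close> by (simp flip: scaleR_diff_right)
    then show "\<exists>e\<in>E. norm (c *\<^sub>R x - e) \<le> c * s"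
      using e \<open>c > 0\<close> subspace_scale[OF E(1)] by (intro bexI[of _ "c *\<^sub>R e"]) auto
  qed
  have le: "p x \<le> norm (x - e)" if "e \<in> E" for x e
    unfolding p_def using that
    by (intro cInf_lower bdd_belowI[of _ 0]) (auto intro: order_trans[OF norm_ge_zero])
  obtain h :: "'a \<Rightarrow>\<^sub>L real" where h: "\<And>x. h x \<le> p x" "h a = p a"
    using hahn_banach_bounded[where K = 1 and a = a, OF sub] le[OF \<open>0 \<in> E\<close>]
    by (metis diff_zero mult_1)
  show thesis
  proof (rule that)
    fix e assume "e \<in> E"
    then show "h e = 0"
      using h(1)[of e] h(1)[of "- e"] le[of e e] le[of "- e" "- e"] subspace_neg[OF E(1)]
      by (simp add: blinfun.minus_right)
  next
    obtain r where r: "r > 0" "ball a r \<subseteq> - E"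
      using openE[of "- E" a] E(2) a by (auto simp: open_Compl)
    have "r \<le> p a"
      unfolding p_def
    proof (rule cInf_greatest)
      show "{s. \<exists>e\<in>E. norm (a - e) \<le> s} \<noteq> {}"
        using \<open>0 \<in> E\<close> by blast
    next
      fix s assume "s \<in> {s. \<exists>e\<in>E. norm (a - e) \<le> s}"
      then obtain e where "e \<in> E" "norm (a - e) \<le> s" by auto
      moreover have "r \<le> norm (a - e)"
        using r \<open>e \<in> E\<close> by (auto simp: dist_norm subset_iff not_less[symmetric])
      ultimately show "r \<le> s" by simp
    qed
    then show "h a \<noteq> 0"
      using h r by simp
  qed
qed

section \<open>Weak sequential compactness in reflexive spaces\<close>

lemma convergent_diagonal_subseq:
  fixes g :: "nat \<Rightarrow> nat \<Rightarrow> real"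
  assumes "\<And>i. bounded (range (g i))"
  obtains r where "strict_mono r" "\<And>i. convergent (\<lambda>n. g i (r n))"
proof -
  interpret S: subseqs "\<lambda>i s. convergent (\<lambda>n. g i (s n))"
  proof
    fix i and s :: "nat \<Rightarrow> nat"
    have "bounded (range (\<lambda>n. g i (s n)))"
      using assms[of i] by (rule bounded_subset) auto
    then obtain l r where "strict_mono r" "((\<lambda>n. g i (s n)) \<circ> r) \<longlonglongrightarrow> l"
      using bounded_imp_convergent_subsequence by blast
    then show "\<exists>r'. strict_mono r' \<and> convergent (\<lambda>n. g i ((s \<circ> r') n))"
      by (auto simp: convergent_def o_def)
  qed
  have "convergent (\<lambda>n. g i (S.diagseq n))" for i
  proof -
    \<comment> \<open>Only the tail of the diagonal sequence is a subsequence of the one chosen to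
      make \<open>g i\<close> converge; the initial segment is dropped and restored
      afterwards.\<close>
    have "convergent (\<lambda>n. g i ((S.diagseq \<circ> (+) (Suc i)) n))"
    proof (rule S.diagseq_holds)
      fix s :: "nat \<Rightarrow> nat" and r n
      assume "convergent (\<lambda>k. g n (s k))" "strict_mono (r :: nat \<Rightarrow> nat)"
      then show "convergent (\<lambda>k. g n ((s \<circ> r) k))"
        using convergent_subseq_convergent[of "\<lambda>k. g n (s k)" r] by (simp add: o_def)
    qed
    then have "convergent (\<lambda>n. g i (S.diagseq (n + Suc i)))"
      by (simp add: o_def add.commute)
    then show ?thesis
      using convergent_ignore_initial_segment[of "\<lambda>n. g i (S.diagseq n)" "Suc i"] by simp
  qed
  with S.subseq_diagseq show thesis
    by (rule that)
qed

text \<open>\<open>d\<close> enumerates the rational combinations of the \<open>x n\<close>. Coding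
  them as lists makes them countable, with sums given by append and rational multiples by
  \<open>map\<close>; real multiples are reached in the closure because the rationals are
  dense.\<close>

lemma countable_dense_span:
  fixes x :: "nat \<Rightarrow> 'a::real_normed_vector"
  obtains d :: "nat \<Rightarrow> 'a" where "subspace (closure (range d))" "range x \<subseteq> range d"
proof -
  define v where "v = (\<lambda>l :: (rat \<times> nat) list. \<Sum>(q, n)\<leftarrow>l. real_of_rat q *\<^sub>R x n)"
  define D where "D = range v"
  have add: "a + b \<in> D" if "a \<in> D" "b \<in> D" for a b
  proof -
    from that obtain l m where "a = v l" "b = v m" by (auto simp: D_def)
    then have "a + b = v (l @ m)" by (simp add: v_def)
    then show ?thesis by (simp add: D_def)
  qed
  have scale: "real_of_rat q *\<^sub>R a \<in> D" if "a \<in> D" for q a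
  proof -
    from that obtain l where "a = v l" by (auto simp: D_def)
    moreover have "real_of_rat q *\<^sub>R v l = v (map (\<lambda>(r, n). (q * r, n)) l)"
      by (induction l) (auto simp: v_def scaleR_add_right of_rat_mult)
    ultimately show ?thesis by (simp add: D_def)
  qed
  have "0 \<in> D"
    by (auto simp: D_def v_def intro!: image_eqI[of _ _ "[]"])
  have "subspace (closure D)"
    unfolding subspace_def
  proof (intro conjI ballI allI)
    show "0 \<in> closure D"
      using \<open>0 \<in> D\<close> closure_subset by blast
  next
    fix a b assume "a \<in> closure D" "b \<in> closure D"
    then obtain s t where st: "\<And>n. s n \<in> D" "s \<longlonglongrightarrow> a" "\<And>n. t n \<in> D" "t \<longlonglongrightarrow> b"
      by (auto simp: closure_sequential)
    then have "(\<lambda>n. s n + t n) \<longlonglongrightarrow> a + b" "\<forall>n. s n + t n \<in> D"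
      by (auto intro: tendsto_add add)
    then show "a + b \<in> closure D"
      unfolding closure_sequential by (intro exI[of _ "\<lambda>n. s n + t n"] conjI)
  next
    fix c :: real and a assume "a \<in> closure D"
    then obtain s where s: "\<And>n. s n \<in> D" "s \<longlonglongrightarrow> a"
      by (auto simp: closure_sequential)
    have "c \<in> closure \<rat>"
      by (simp add: Rats_closure_real)
    then obtain q where q: "\<And>n. q n \<in> \<rat>" "q \<longlonglongrightarrow> c"
      by (auto simp: closure_sequential)
    have "(\<lambda>n. q n *\<^sub>R s n) \<longlonglongrightarrow> c *\<^sub>R a"
      using q s by (intro tendsto_scaleR)
    moreover have "q n *\<^sub>R s n \<in> D" for n
      using q(1)[of n] scale[OF s(1)[of n]] by (auto elim: Rats_cases)
    ultimately show "c *\<^sub>R a \<in> closure D"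
      unfolding closure_sequential by (intro exI[of _ "\<lambda>n. q n *\<^sub>R s n"] conjI allI)
  qed
  moreover have "x n \<in> D" for n
    by (auto simp: D_def v_def intro!: image_eqI[of _ _ "[(1, n)]"])
  moreover have "range (\<lambda>n. v (from_nat n)) = D"
    using image_image[of v from_nat UNIV] by (simp add: D_def)
  ultimately show thesis
    by (intro that[of "\<lambda>n. v (from_nat n)"]) auto
qed

text \<open>
  The two conclusions say that \<open>liminf g (x n) \<le> g l \<le> limsup g (x n)\<close> for all \<open>g\<close>, with equality
  on the right for \<open>g = f\<close>: the point \<open>l\<close> represents a functional on the dual that is dominated by
  the sublinear functional \<open>limsup\<close> and agrees with it at \<open>f\<close>.
\<close>

lemma reflexive_weak_cluster_point:
  fixes x :: "nat \<Rightarrow> 'a::real_normed_vector" and f :: "'a \<Rightarrow>\<^sub>L real"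
  assumes refl: "reflexive_space TYPE('a)" and M: "\<And>n. norm (x n) \<le> M"
  obtains l where "\<And>(g :: 'a \<Rightarrow>\<^sub>L real) c. \<forall>\<^sub>F n in sequentially. g (x n) \<le> c \<Longrightarrow> g l \<le> c"
    "\<And>c. f l < c \<Longrightarrow> \<forall>\<^sub>F n in sequentially. f (x n) \<le> c"
proof -
  define p where
    "p = (\<lambda>g :: 'a \<Rightarrow>\<^sub>L real. Inf {s. \<forall>\<^sub>F n in sequentially. g (x n) \<le> s})"
  have abs: "\<bar>g (x n)\<bar> \<le> M * norm g" for g :: "'a \<Rightarrow>\<^sub>L real" and n
  proof -
    have "\<bar>g (x n)\<bar> \<le> norm g * norm (x n)"
      using norm_blinfun[of g "x n"] by simp
    also have "\<dots> \<le> norm g * M"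
      using M by (intro mult_left_mono) auto
    finally show ?thesis by (simp add: mult.commute)
  qed
  have below: "- (M * norm g) \<le> s" if "\<forall>\<^sub>F n in sequentially. g (x n) \<le> s"
    for g :: "'a \<Rightarrow>\<^sub>L real" and s
  proof -
    from that obtain n where "g (x n) \<le> s"
      using eventually_happens'[OF sequentially_bot] by blast
    then show ?thesis using abs[of g n] by linarith
  qed
  have upper: "\<forall>\<^sub>F n in sequentially. g (x n) \<le> M * norm g" for g :: "'a \<Rightarrow>\<^sub>L real"
    using abs[of g] by (intro always_eventually) (simp add: abs_le_iff)
  have sub: "sublinear p"
    unfolding p_def
  proof (rule sublinear_Inf[where b = "\<lambda>g. - (M * norm g)"])
    show "\<exists>s. \<forall>\<^sub>F n in sequentially. g (x n) \<le> s" for g :: "'a \<Rightarrow>\<^sub>L real"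
      using upper by blast
    show "- (M * norm g) \<le> s" if "\<forall>\<^sub>F n in sequentially. g (x n) \<le> s"
      for g :: "'a \<Rightarrow>\<^sub>L real" and s
      using that by (rule below)
  next
    fix g h :: "'a \<Rightarrow>\<^sub>L real" and s t
    assume "\<forall>\<^sub>F n in sequentially. g (x n) \<le> s" "\<forall>\<^sub>F n in sequentially. h (x n) \<le> t"
    then show "\<forall>\<^sub>F n in sequentially. (g + h) (x n) \<le> s + t"
      by eventually_elim (simp add: blinfun.add_left)
  next
    fix c :: real and g :: "'a \<Rightarrow>\<^sub>L real" and s
    assume "c > 0" "\<forall>\<^sub>F n in sequentially. g (x n) \<le> s"
    from this(2) show "\<forall>\<^sub>F n in sequentially. (c *\<^sub>R g) (x n) \<le> c * s"
      by eventually_elim (use \<open>c > 0\<close> in \<open>simp add: blinfun.scaleR_left\<close>)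
  qed
  have le: "p g \<le> s" if "\<forall>\<^sub>F n in sequentially. g (x n) \<le> s" for g :: "'a \<Rightarrow>\<^sub>L real" and s
    unfolding p_def using that below
    by (intro cInf_lower bdd_belowI[of _ "- (M * norm g)"]) auto
  obtain F where F: "\<And>g. blinfun_apply F g \<le> p g" "F f = p f"
    using hahn_banach_bounded[OF sub le[OF upper], of f] by metis
  \<comment> \<open>Reflexivity enters only here, turning the functional on the dual into a
    point.\<close>
  obtain l :: 'a where l: "F = bidual_embedding l"
    using refl by (auto simp: reflexive_space_def surj_def)
  show thesis
  proof (rule that)
    fix g :: "'a \<Rightarrow>\<^sub>L real" and c assume "\<forall>\<^sub>F n in sequentially. g (x n) \<le> c"
    then show "g l \<le> c"
      using le F(1)[of g] l by fastforce
  next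
    fix c assume "f l < c"
    then have "p f < c"
      using F(2) l by simp
    moreover have "{s. \<forall>\<^sub>F n in sequentially. f (x n) \<le> s} \<noteq> {}"
      using upper by blast
    ultimately obtain s where s: "\<forall>\<^sub>F n in sequentially. f (x n) \<le> s" "s < c"
      using cInf_lessD[of "{s. \<forall>\<^sub>F n in sequentially. f (x n) \<le> s}" c]
      unfolding p_def by blast
    from s(1) show "\<forall>\<^sub>F n in sequentially. f (x n) \<le> c"
      by eventually_elim (use s(2) in simp)
  qed
qed

text \<open>
  A subsequence along which countably many functionals norming the closed span of the sequence
  converge has at most one weak cluster point.
\<close>

theorem reflexive_weakly_convergent_subseq:
  fixes x :: "nat \<Rightarrow> 'a::real_normed_vector"
  assumes refl: "reflexive_space TYPE('a)" and M: "\<And>n. norm (x n) \<le> M"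
  obtains r l where "strict_mono r" "weakly_converges (x \<circ> r) l"
proof -
  obtain d :: "nat \<Rightarrow> 'a" where d: "subspace (closure (range d))" "range x \<subseteq> range d"
    by (rule countable_dense_span)
  have "\<exists>h :: 'a \<Rightarrow>\<^sub>L real. (\<forall>z. h z \<le> norm z) \<and> h (d i) = norm (d i)" for i
    using support_functional[of "d i"] by metis
  then obtain h :: "nat \<Rightarrow> 'a \<Rightarrow>\<^sub>L real"
    where h: "\<And>i z. h i z \<le> norm z" "\<And>i. h i (d i) = norm (d i)"
    by metis
  have "bounded (range (\<lambda>n. h i (x n)))" for i
    unfolding bounded_iff
  proof (intro exI[of _ M] ballI)
    fix y assume "y \<in> range (\<lambda>n. h i (x n))"
    then obtain n where "y = h i (x n)" by auto
    then show "norm y \<le> M"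
      using h(1)[of i "x n"] h(1)[of i "- x n"] M[of n]
      by (simp add: blinfun.minus_right abs_le_iff)
  qed
  then obtain r where r: "strict_mono r" "\<And>i. convergent (\<lambda>n. h i (x (r n)))"
    using convergent_diagonal_subseq[of "\<lambda>i n. h i (x n)"] by metis
  define y where "y = x \<circ> r"
  \<comment> \<open>One-sided form of a weak cluster point: eventual upper bounds pass to
    \<open>l\<close>. Lower bounds follow by applying it to \<open>- g\<close>.\<close>
  define cl where "cl = (\<lambda>l. \<forall>(g :: 'a \<Rightarrow>\<^sub>L real) c.
    (\<forall>\<^sub>F n in sequentially. g (y n) \<le> c) \<longrightarrow> g l \<le> c)"
  have lim: "g l = L" if "cl l" "(\<lambda>n. g (y n)) \<longlonglongrightarrow> L" for l L and g :: "'a \<Rightarrow>\<^sub>L real"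
  proof (rule antisym)
    show "g l \<le> L"
    proof (rule field_le_epsilon)
      fix e :: real assume "e > 0"
      then have "\<forall>\<^sub>F n in sequentially. g (y n) < L + e"
        using that(2) by (intro order_tendstoD) auto
      then have "\<forall>\<^sub>F n in sequentially. g (y n) \<le> L + e"
        by eventually_elim simp
      then show "g l \<le> L + e"
        using that(1) by (auto simp: cl_def)
    qed
    show "L \<le> g l"
    proof (rule field_le_epsilon)
      fix e :: real assume "e > 0"
      then have "\<forall>\<^sub>F n in sequentially. g (y n) > L - e"
        using that(2) by (intro order_tendstoD) auto
      then have "\<forall>\<^sub>F n in sequentially. (- g) (y n) \<le> - (L - e)"
        by eventually_elim (simp add: blinfun.minus_left)
      then have "(- g) l \<le> - (L - e)"
        using that(1) unfolding cl_def by blast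
      then show "L \<le> g l + e"
        by (simp add: blinfun.minus_left)
    qed
  qed
  \<comment> \<open>A functional separating \<open>l\<close> from this closed subspace would vanish
    along \<open>y\<close> and hence at \<open>l\<close>.\<close>
  have mem: "l \<in> closure (range d)" if "cl l" for l
  proof (rule ccontr)
    assume "l \<notin> closure (range d)"
    then obtain g :: "'a \<Rightarrow>\<^sub>L real"
      where g: "\<And>e. e \<in> closure (range d) \<Longrightarrow> g e = 0" "g l \<noteq> 0"
      using separation_closed_subspace[OF d(1)] by auto
    have "y n \<in> closure (range d)" for n
      using d(2) closure_subset unfolding y_def by fastforce
    then have "(\<lambda>n. g (y n)) \<longlonglongrightarrow> 0"
      using g(1) by simp
    with that g(2) lim show False by blast
  qed
  have unique: "l = l'" if "cl l" "cl l'" for l l'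
  proof (rule ccontr)
    assume "l \<noteq> l'"
    have zero: "h i (l - l') = 0" for i
    proof -
      obtain L where "(\<lambda>n. h i (y n)) \<longlonglongrightarrow> L"
        using r(2)[of i] by (auto simp: convergent_def y_def)
      then show ?thesis
        using lim that by (simp add: blinfun.diff_right)
    qed
    have "l - l' \<in> closure (range d)"
      using mem that subspace_diff[OF d(1)] by blast
    moreover have "norm (l - l') / 2 > 0"
      using \<open>l \<noteq> l'\<close> by simp
    ultimately obtain i where i: "dist (d i) (l - l') < norm (l - l') / 2"
      unfolding closure_approachable by blast
    \<comment> \<open>\<open>h i\<close> norms \<open>d i\<close> and kills \<open>l - l'\<close>,
      so the norm of \<open>d i\<close> is at most its distance to \<open>l - l'\<close>, which is
      too small.\<close>
    have "norm (d i) = h i (d i - (l - l'))"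
      using h(2) zero by (simp add: blinfun.diff_right)
    also have "\<dots> \<le> dist (d i) (l - l')"
      using h(1) by (simp add: dist_norm)
    finally have "norm (l - l') \<le> 2 * dist (d i) (l - l')"
      using norm_triangle_ineq3[of "d i" "l - l'"] by (simp add: dist_norm)
    with i show False by simp
  qed
  have yM: "norm (y n) \<le> M" for n
    using M by (simp add: y_def)
  have cluster: "\<exists>l. cl l \<and> (\<forall>c. f l < c \<longrightarrow> (\<forall>\<^sub>F n in sequentially. f (y n) \<le> c))"
    for f :: "'a \<Rightarrow>\<^sub>L real"
    using reflexive_weak_cluster_point[where x = y and f = f, OF refl yM]
    unfolding cl_def by metis
  obtain l where l: "cl l"
    using cluster[of 0] by blast
  \<comment> \<open>Each \<open>f\<close> has its own cluster point at which its upper limit is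
    taken; uniqueness identifies all of them with \<open>l\<close>.\<close>
  have up: "\<forall>\<^sub>F n in sequentially. f (y n) \<le> c" if "f l < c" for f :: "'a \<Rightarrow>\<^sub>L real" and c
    using cluster[of f] unique[OF l] that by blast
  have "weakly_converges y l"
    unfolding weakly_converges_def
  proof (intro allI order_tendstoI)
    fix f :: "'a \<Rightarrow>\<^sub>L real" and c assume "f l < c"
    then have "\<forall>\<^sub>F n in sequentially. f (y n) \<le> (f l + c) / 2"
      by (intro up) simp
    then show "\<forall>\<^sub>F n in sequentially. f (y n) < c"
      by eventually_elim (use \<open>f l < c\<close> in simp)
  next
    fix f :: "'a \<Rightarrow>\<^sub>L real" and c assume "c < f l"
    then have "\<forall>\<^sub>F n in sequentially. (- f) (y n) \<le> - ((f l + c) / 2)"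
      by (intro up) (simp add: blinfun.minus_left)
    then show "\<forall>\<^sub>F n in sequentially. c < f (y n)"
      by eventually_elim (use \<open>c < f l\<close> in \<open>simp add: blinfun.minus_left\<close>)
  qed
  with r(1) show thesis
    unfolding y_def by (rule that)
qed

section \<open>Smooth operators and norm attainment\<close>

lemma norm_blinfun_bound_sphere:
  fixes A :: "'a::real_normed_vector \<Rightarrow>\<^sub>L 'b::real_normed_vector"
  assumes "0 \<le> b" and bound: "\<And>x. norm x = 1 \<Longrightarrow> norm (A x) \<le> b"
  shows "norm A \<le> b"
proof (rule norm_blinfun_bound)
  fix x
  show "norm (A x) \<le> b * norm x"
  proof (cases "x = 0")
    case False
    have "A x = norm x *\<^sub>R A (x /\<^sub>R norm x)"
      using False by (simp add: blinfun.scaleR_right)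
    moreover have "norm (A (x /\<^sub>R norm x)) \<le> b"
      using False by (intro bound) simp
    ultimately show ?thesis
      by (simp add: mult.commute[of b] mult_left_mono)
  qed (simp add: blinfun.zero_right)
qed fact

lemma norm_blinfun_sphere_le:
  fixes A :: "'a::real_normed_vector \<Rightarrow>\<^sub>L 'b::real_normed_vector"
  assumes "norm x = 1"
  shows "norm (A x) \<le> norm A"
  using norm_blinfun[of A x] assms by simp

text \<open>A functional \<open>h\<close> below the one-sided derivative of the norm at
  \<open>y\<close> supports \<open>y\<close>, so smoothness makes it \<open>g\<close>. Choosing
  \<open>h\<close> to agree with the derivative in direction \<open>b\<close> shows that this
  derivative is \<open>g b = 0\<close>.\<close>

lemma smooth_element_small_increment:
  fixes g :: "'a::real_normed_vector \<Rightarrow>\<^sub>L real"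
  assumes smooth: "smooth_element y" and g: "norm g = 1" "g y = norm y"
    and b: "g b = 0" and "e > 0"
  obtains s where "s > 0" "norm (y + s *\<^sub>R b) \<le> norm y + e * s"
proof -
  let ?q = "directional norm y"
  have "?q x \<le> 1 * norm x" for x
    using directional_le_self[OF sublinear_norm, of y x] by simp
  from hahn_banach_bounded[OF sublinear_directional[OF sublinear_norm] this, of b]
  obtain h :: "'a \<Rightarrow>\<^sub>L real" where h: "\<And>x. h x \<le> ?q x" "h b = ?q b"
    by metis
  have le: "h x \<le> norm x" for x
    using h(1)[of x] directional_le_self[OF sublinear_norm, of y x] by simp
  have "h (- y) \<le> - norm y"
    using h(1)[of "- y"] directional_minus[OF sublinear_norm, of y] by simp
  then have hy: "h y = norm y"
    using le[of y] by (simp add: blinfun.minus_right)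
  moreover have "norm h = 1"
    using smooth norm_blinfun_eq_one[OF le hy] by (simp add: smooth_element_def)
  ultimately have "h = g"
    using smooth g unfolding smooth_element_def by blast
  then have "?q b < e"
    using h(2) b \<open>e > 0\<close> by simp
  then obtain t where t: "t \<ge> 0" "norm (b + t *\<^sub>R y) - t * norm y < e"
    using directional_lessD by blast
  \<comment> \<open>\<open>t\<close> may be \<open>0\<close>; passing to \<open>t + 1\<close>
    preserves the estimate and permits the step size \<open>1 / u\<close>.\<close>
  define u where "u = t + 1"
  have u: "u > 0" using t by (simp add: u_def)
  have "norm (b + u *\<^sub>R y) \<le> norm (b + t *\<^sub>R y) + norm y"
    using norm_triangle_ineq[of "b + t *\<^sub>R y" y] by (simp add: u_def algebra_simps)
  then have bound: "norm (b + u *\<^sub>R y) \<le> u * norm y + e"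
    using t by (simp add: u_def algebra_simps)
  have "y + (1 / u) *\<^sub>R b = (1 / u) *\<^sub>R (b + u *\<^sub>R y)"
    using u by (simp add: algebra_simps)
  then have "norm (y + (1 / u) *\<^sub>R b) = (1 / u) * norm (b + u *\<^sub>R y)"
    using u by simp
  also have "\<dots> \<le> (1 / u) * (u * norm y + e)"
    using u bound by (intro mult_left_mono) auto
  also have "\<dots> = norm y + e * (1 / u)"
    using u by (simp add: field_simps)
  finally show thesis
    using u by (intro that[of "1 / u"]) auto
qed

section \<open>Support functionals of operators and uniqueness of norm attainment\<close>

definition evaluation ::
    "('b::real_normed_vector \<Rightarrow>\<^sub>L real) \<Rightarrow> 'a::real_normed_vector \<Rightarrow> ('a \<Rightarrow>\<^sub>L 'b) \<Rightarrow>\<^sub>L real" where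
  "evaluation g x = Blinfun (\<lambda>S :: 'a \<Rightarrow>\<^sub>L 'b. g (S x))"

lemma evaluation_apply [simp]: "evaluation g x S = g (blinfun_apply S x)"
proof -
  have "bounded_linear (\<lambda>S. blinfun_apply g (blinfun_apply S x))"
    by (intro bounded_linear_compose[OF blinfun.bounded_linear_right] blinfun.bounded_linear_left)
  then show ?thesis
    by (simp add: evaluation_def bounded_linear_Blinfun_apply)
qed

text \<open>Norm attainment at \<open>x\<close> thus yields a support functional at \<open>A\<close>
  itself, since \<open>evaluation g x\<close> takes the value \<open>norm A\<close> there.\<close>

lemma norm_evaluation_eq_one:
  fixes A :: "'a::real_normed_vector \<Rightarrow>\<^sub>L 'b::real_normed_vector" and g :: "'b \<Rightarrow>\<^sub>L real"
  assumes "norm x = 1" "A \<noteq> 0" "norm (A x) = norm A"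
    and g: "\<And>z. g z \<le> norm z" "g (A x) = norm (A x)"
  shows "norm (evaluation g x) = 1"
proof (rule norm_blinfun_eq_one)
  fix S
  show "evaluation g x S \<le> norm S"
    using g(1)[of "S x"] norm_blinfun_sphere_le[OF assms(1), of S] by simp
next
  show "evaluation g x A = norm A"
    using assms by simp
qed (use assms in auto)

definition rank_one ::
    "('a::real_normed_vector \<Rightarrow>\<^sub>L real) \<Rightarrow> 'b::real_normed_vector \<Rightarrow> 'a \<Rightarrow>\<^sub>L 'b" where
  "rank_one f y = blinfun_scaleR_left y o\<^sub>L f"

lemma rank_one_apply [simp]: "rank_one f y x = f x *\<^sub>R y"
  by (simp add: rank_one_def)

lemma norm_rank_one_le: "norm (rank_one f y) \<le> norm f * norm y"
proof (rule norm_blinfun_bound_sphere)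
  fix x :: 'a assume "norm x = 1"
  then show "norm (rank_one f y x) \<le> norm f * norm y"
    using norm_blinfun_sphere_le[of x f] by (simp add: mult_right_mono)
qed simp

text \<open>The evaluations at \<open>u\<close> and at \<open>v\<close> both support
  \<open>A\<close>, so they coincide. Testing them on rank-one operators makes \<open>u\<close> and
  \<open>v\<close> parallel.\<close>

lemma smooth_operator_norm_attainment_unique:
  fixes A :: "'a::real_normed_vector \<Rightarrow>\<^sub>L 'b::real_normed_vector"
  assumes smooth: "smooth_element A"
    and u: "u \<in> norm_attainment_set A" and v: "v \<in> norm_attainment_set A"
  shows "v = u \<or> v = - u"
proof -
  have A: "A \<noteq> 0"
    using smooth by (simp add: smooth_element_def)
  obtain g :: "'b \<Rightarrow>\<^sub>L real" where g: "\<And>z. g z \<le> norm z" "g (A u) = norm (A u)"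
    using support_functional by metis
  obtain h :: "'b \<Rightarrow>\<^sub>L real" where h: "\<And>z. h z \<le> norm z" "h (A v) = norm (A v)"
    using support_functional by metis
  have "norm (evaluation g u) = 1" "norm (evaluation h v) = 1"
    using A u v g h by (auto simp: norm_attainment_set_def intro!: norm_evaluation_eq_one)
  moreover have "evaluation g u A = norm A" "evaluation h v A = norm A"
    using u v g h by (auto simp: norm_attainment_set_def)
  ultimately have eq: "evaluation g u = evaluation h v"
    using smooth by (auto simp: smooth_element_def)
  have eq2: "norm A *\<^sub>R u = h (A u) *\<^sub>R v"
  proof (rule blinfun_real_eqI)
    fix f :: "'a \<Rightarrow>\<^sub>L real"
    \<comment> \<open>This reads \<open>f u * g (A u) = f v * h (A u)\<close>, where
      \<open>g (A u) = norm A\<close>.\<close>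
    have "evaluation g u (rank_one f (A u)) = evaluation h v (rank_one f (A u))"
      using eq by simp
    then show "f (norm A *\<^sub>R u) = f (h (A u) *\<^sub>R v)"
      using g(2) u by (simp add: blinfun.scaleR_right norm_attainment_set_def mult.commute)
  qed
  then have "norm (norm A *\<^sub>R u) = norm (h (A u) *\<^sub>R v)"
    by simp
  then have "\<bar>h (A u)\<bar> = norm A"
    using u v by (simp add: norm_attainment_set_def)
  then have "h (A u) = norm A \<or> h (A u) = - norm A"
    by linarith
  then have "norm A *\<^sub>R u = norm A *\<^sub>R v \<or> norm A *\<^sub>R u = norm A *\<^sub>R (- v)"
    using eq2 by auto
  then have "u = v \<or> u = - v"
    using A unfolding scaleR_cancel_left by auto
  then show ?thesis
    by auto
qed

section \<open>Strong norm attainment and smoothness\<close>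

definition strongly_attains ::
    "('a::real_normed_vector \<Rightarrow>\<^sub>L 'b::real_normed_vector) \<Rightarrow> 'a \<Rightarrow> bool" where
  "strongly_attains A x0 \<longleftrightarrow> norm A = 1 \<and> norm x0 = 1 \<and> norm (A x0) = 1 \<and>
     (\<forall>r>0. \<exists>\<delta>>0. \<forall>x. norm x = 1 \<longrightarrow> norm (A x) > 1 - \<delta> \<longrightarrow>
        norm (x - x0) < r \<or> norm (x + x0) < r)"

lemma strongly_attains_norms:
  assumes "strongly_attains A x0"
  shows "norm A = 1" "norm x0 = 1" "norm (blinfun_apply A x0) = 1"
  using assms unfolding strongly_attains_def by blast+

text \<open>
  For small \<open>t\<close> the norm of \<open>A + t S\<close> is almost attained only near \<open>\<plusminus>x0\<close>, where convexity in \<open>t\<close>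
  and smoothness of the norm at \<open>A x0\<close> bound it by \<open>1 + 2 e t\<close>.
\<close>

lemma support_functional_strongly_attains_nonpos:
  fixes A S :: "'a::real_normed_vector \<Rightarrow>\<^sub>L 'b::real_normed_vector"
    and g :: "'b \<Rightarrow>\<^sub>L real" and F :: "('a \<Rightarrow>\<^sub>L 'b) \<Rightarrow>\<^sub>L real"
  assumes attains: "strongly_attains A x0" and smooth: "smooth_element (A x0)"
    and g: "norm g = 1" "g (A x0) = 1" and S: "g (S x0) = 0"
    and F: "norm F = 1" "F A = 1"
  shows "F S \<le> 0"
proof (rule field_le_epsilon)
  fix e2 :: real assume "e2 > 0"
  define e where "e = e2 / 2"
  have e: "e > 0" using \<open>e2 > 0\<close> by (simp add: e_def)
  note a = strongly_attains_norms[OF attains]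
  have "g (A x0) = norm (A x0)"
    using g(2) a by simp
  from smooth_element_small_increment[OF smooth g(1) this S e]
  obtain s where s: "s > 0" "norm (A x0 + s *\<^sub>R S x0) \<le> norm (A x0) + e * s" .
  have s1: "norm ((A + s *\<^sub>R S) x0) \<le> 1 + e * s"
    using s a by (simp add: blinfun.add_left blinfun.scaleR_left)
  have "((\<lambda>x. norm ((A + s *\<^sub>R S) x)) \<longlongrightarrow> norm ((A + s *\<^sub>R S) x0)) (at x0)"
    by (intro tendsto_intros)
  moreover have "norm ((A + s *\<^sub>R S) x0) < 1 + 2 * e * s"
    using s1 mult_pos_pos[OF e s(1)] by linarith
  ultimately have "\<forall>\<^sub>F x in at x0. norm ((A + s *\<^sub>R S) x) < 1 + 2 * e * s"
    by (rule order_tendstoD)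
  then obtain r where r: "r > 0"
    "\<And>x. x \<noteq> x0 \<Longrightarrow> dist x x0 < r \<Longrightarrow> norm ((A + s *\<^sub>R S) x) < 1 + 2 * e * s"
    by (auto simp: eventually_at)
  \<comment> \<open>The limit controls only the punctured ball; \<open>x0\<close> itself is covered
    by \<open>s1\<close>.\<close>
  have near: "norm ((A + s *\<^sub>R S) x) \<le> 1 + 2 * e * s" if "norm (x - x0) < r" for x
    using r(2)[of x] that s1 mult_pos_pos[OF e s(1)]
    by (cases "x = x0") (auto simp: dist_norm less_imp_le)
  have near': "norm ((A + s *\<^sub>R S) x) \<le> 1 + 2 * e * s" if "norm (x + x0) < r" for x
  proof -
    have "norm (- x - x0) < r"
      using that norm_minus_cancel[of "x + x0"] by simp
    from near[OF this] show ?thesis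
      by (simp only: blinfun.minus_right norm_minus_cancel)
  qed
  obtain \<delta> where \<delta>: "\<delta> > 0" "\<And>x. norm x = 1 \<Longrightarrow> norm (A x) > 1 - \<delta> \<Longrightarrow>
      norm (x - x0) < r \<or> norm (x + x0) < r"
    using attains r(1) unfolding strongly_attains_def by meson
  \<comment> \<open>\<open>t \<le> s\<close> allows convex interpolation near \<open>x0\<close> and
    \<open>- x0\<close>; \<open>t * norm S \<le> \<delta>\<close> keeps the norm at most
    \<open>1\<close> where \<open>A\<close> is \<open>\<delta>\<close> away from attaining. The
    summand \<open>1\<close> avoids division by zero.\<close>
  define t where "t = min s (\<delta> / (norm S + 1))"
  have nS: "norm S + 1 > 0"
    by (simp add: add_nonneg_pos)
  have t: "t > 0" "t \<le> s"
    using s(1) \<delta>(1) nS by (auto simp: t_def)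
  have "t \<le> \<delta> / (norm S + 1)"
    by (simp add: t_def)
  then have "t * (norm S + 1) \<le> \<delta>"
    using nS by (simp add: pos_le_divide_eq)
  then have t\<delta>: "t * norm S \<le> \<delta>"
    using t by (simp add: algebra_simps)
  have "norm (A + t *\<^sub>R S) \<le> 1 + 2 * e * t"
  proof (rule norm_blinfun_bound_sphere)
    fix x :: 'a assume x: "norm x = 1"
    have Ax: "norm (A x) \<le> 1"
      using norm_blinfun_sphere_le[OF x, of A] a by simp
    show "norm ((A + t *\<^sub>R S) x) \<le> 1 + 2 * e * t"
    proof (cases "norm (A x) > 1 - \<delta>")
      case True
      then have ns: "norm ((A + s *\<^sub>R S) x) \<le> 1 + 2 * e * s"
        using \<delta>(2)[OF x] near near' by blast
      have "(A + t *\<^sub>R S) x = (1 - t / s) *\<^sub>R A x + (t / s) *\<^sub>R (A + s *\<^sub>R S) x"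
        using s(1) by (simp add: blinfun.add_left blinfun.scaleR_left algebra_simps)
      then have "norm ((A + t *\<^sub>R S) x)
          \<le> norm ((1 - t / s) *\<^sub>R A x) + norm ((t / s) *\<^sub>R (A + s *\<^sub>R S) x)"
        by (metis norm_triangle_ineq)
      also have "\<dots> = (1 - t / s) * norm (A x) + (t / s) * norm ((A + s *\<^sub>R S) x)"
        using s(1) t by simp
      also have "\<dots> \<le> (1 - t / s) * 1 + (t / s) * (1 + 2 * e * s)"
        using s(1) t Ax ns by (intro add_mono mult_left_mono) auto
      also have "\<dots> = 1 + 2 * e * t"
        using s(1) by (simp add: field_simps)
      finally show ?thesis .
    next
      case False
      have "norm ((A + t *\<^sub>R S) x) \<le> norm (A x) + norm (t *\<^sub>R S x)"
        using norm_triangle_ineq[of "A x" "t *\<^sub>R S x"]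
        by (simp add: blinfun.add_left blinfun.scaleR_left)
      also have "\<dots> \<le> norm (A x) + t * norm S"
        using t norm_blinfun_sphere_le[OF x, of S] by simp
      also have "\<dots> \<le> 1"
        using False t\<delta> by simp
      also have "\<dots> \<le> 1 + 2 * e * t"
        using e t by simp
      finally show ?thesis .
    qed
  qed (use e t in simp)
  then have "F (A + t *\<^sub>R S) \<le> 1 + 2 * e * t"
    using blinfun_real_le[of F "A + t *\<^sub>R S"] F by simp
  then have "t * F S \<le> t * (2 * e)"
    using F by (simp add: blinfun.add_right blinfun.scaleR_right mult.commute)
  then show "F S \<le> 0 + e2"
    using t by (simp add: e_def)
qed

text \<open>Subtracting \<open>g (S x0) *\<^sub>R A\<close> from \<open>S\<close> leaves an operator
  \<open>S'\<close> to which the preceding bound applies with both signs. Hence every support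
  functional at \<open>A\<close> kills \<open>S'\<close>, which determines its value at
  \<open>S\<close>.\<close>

theorem strongly_attains_imp_smooth:
  fixes A :: "'a::real_normed_vector \<Rightarrow>\<^sub>L 'b::real_normed_vector"
  assumes attains: "strongly_attains A x0" and smooth: "smooth_element (A x0)"
  shows "smooth_element A"
proof -
  note a = strongly_attains_norms[OF attains]
  have A: "A \<noteq> 0"
    using a by auto
  obtain g :: "'b \<Rightarrow>\<^sub>L real" where g: "\<And>z. g z \<le> norm z" "g (A x0) = norm (A x0)"
    using support_functional by metis
  have g1: "norm g = 1"
    using g a by (intro norm_blinfun_eq_one[of g "A x0"]) auto
  have "F = evaluation g x0" if F: "norm F = 1" "F A = norm A"
    for F :: "('a \<Rightarrow>\<^sub>L 'b) \<Rightarrow>\<^sub>L real"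
  proof (rule blinfun_eqI)
    fix S :: "'a \<Rightarrow>\<^sub>L 'b"
    define S' where "S' = S - g (S x0) *\<^sub>R A"
    have "g (S' x0) = 0" "g ((- S') x0) = 0"
      using g(2) a by (simp_all add: S'_def blinfun.diff_left blinfun.diff_right blinfun.scaleR_left
          blinfun.scaleR_right blinfun.minus_left blinfun.minus_right)
    then have "F S' \<le> 0" "F (- S') \<le> 0"
      using support_functional_strongly_attains_nonpos[OF attains smooth g1, of _ F] g a F
      by auto
    then have "F S' = 0"
      by (simp add: blinfun.minus_right)
    then show "F S = evaluation g x0 S"
      using F a by (simp add: S'_def blinfun.diff_right blinfun.scaleR_right)
  qed
  moreover have "norm (evaluation g x0) = 1"
    using a g A by (intro norm_evaluation_eq_one) auto
  moreover have "evaluation g x0 A = norm A"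
    using a g by simp
  ultimately show ?thesis
    using A unfolding smooth_element_def by blast
qed

section \<open>Compact operators on reflexive Kadets--Klee spaces\<close>

text \<open>A subsequence converges weakly to some \<open>l\<close>. Compactness makes images
  converge in norm along a further subsequence, necessarily to \<open>T l\<close>; so
  \<open>norm (T l) = 1\<close>, which forces \<open>norm l = 1\<close>, and the Kadets--Klee
  property upgrades weak to norm convergence.\<close>

lemma compact_operator_maximizing_sequence:
  fixes T :: "'a::real_normed_vector \<Rightarrow>\<^sub>L 'b::real_normed_vector"
  assumes refl: "reflexive_space TYPE('a)" and kk: "kadets_klee TYPE('a)"
    and compact: "compact_operator T" and T: "norm T = 1"
    and x: "\<And>n. norm (x n) = 1" and lim: "(\<lambda>n. norm (T (x n))) \<longlonglongrightarrow> 1"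
  obtains r l where "strict_mono r" "(x \<circ> r) \<longlonglongrightarrow> l" "l \<in> norm_attainment_set T"
proof -
  obtain r l where r: "strict_mono r" "weakly_converges (x \<circ> r) l"
    using reflexive_weakly_convergent_subseq[OF refl, of x 1] x by auto
  have weak: "(\<lambda>n. f (x (r n))) \<longlonglongrightarrow> f l" for f :: "'a \<Rightarrow>\<^sub>L real"
    using r(2) by (simp add: weakly_converges_def)
  have mem: "T (x (r n)) \<in> closure (blinfun_apply T ` cball 0 1)" for n
    using x[of "r n"] by (intro subsetD[OF closure_subset] imageI) simp
  have "seq_compact (closure (blinfun_apply T ` cball 0 1))"
    using compact by (simp add: compact_operator_def compact_imp_seq_compact)
  then obtain k z where k: "strict_mono k" "((\<lambda>n. T (x (r n))) \<circ> k) \<longlonglongrightarrow> z"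
    by (rule seq_compactE[of _ "\<lambda>n. T (x (r n))"]) (use mem in blast)+
  then have kz: "(\<lambda>n. T (x (r (k n)))) \<longlonglongrightarrow> z"
    by (simp add: o_def)
  have "z = T l"
  proof (rule blinfun_real_eqI)
    fix h :: "'b \<Rightarrow>\<^sub>L real"
    have "(\<lambda>n. h (T (x (r n)))) \<longlonglongrightarrow> h (T l)"
      using weak[of "h o\<^sub>L T"] by simp
    from LIMSEQ_subseq_LIMSEQ[OF this k(1)]
    have "(\<lambda>n. h (T (x (r (k n))))) \<longlonglongrightarrow> h (T l)"
      by (simp add: o_def)
    moreover have "(\<lambda>n. h (T (x (r (k n))))) \<longlonglongrightarrow> h z"
      using kz by (intro tendsto_intros)
    ultimately show "h z = h (T l)"
      using LIMSEQ_unique by blast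
  qed
  moreover have "norm z = 1"
  proof -
    have "(\<lambda>n. norm (T (x (r (k n))))) \<longlonglongrightarrow> 1"
      using LIMSEQ_subseq_LIMSEQ[OF lim, of "r \<circ> k"] r(1) k(1)
      by (simp add: o_def strict_mono_def)
    moreover have "(\<lambda>n. norm (T (x (r (k n))))) \<longlonglongrightarrow> norm z"
      using kz by (intro tendsto_intros)
    ultimately show ?thesis
      using LIMSEQ_unique by blast
  qed
  ultimately have Tl: "norm (T l) = 1"
    by simp
  \<comment> \<open>Weak lower semicontinuity of the norm, tested on a support functional at
    \<open>l\<close>.\<close>
  have "norm l \<le> 1"
  proof -
    obtain h :: "'a \<Rightarrow>\<^sub>L real" where h: "\<And>z. h z \<le> norm z" "h l = norm l"
      using support_functional by metis
    have "h (x (r n)) \<le> 1" for n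
      using h(1)[of "x (r n)"] x by simp
    with weak[of h] have "h l \<le> 1"
      by (intro LIMSEQ_le_const2) auto
    with h(2) show ?thesis by simp
  qed
  moreover have "norm l \<ge> 1"
    using norm_blinfun[of T l] T Tl by simp
  ultimately have l: "norm l = 1"
    by simp
  then have "(x \<circ> r) \<longlonglongrightarrow> l"
    using kk r(2) x by (auto simp: kadets_klee_def)
  with r(1) show thesis
    using l Tl T by (intro that) (auto simp: norm_attainment_set_def)
qed

lemma one_minus_inverse_Suc_tendsto:
  assumes "\<And>n. 1 - 1 / real (Suc n) \<le> a n" "\<And>n. a n \<le> 1"
  shows "a \<longlonglongrightarrow> 1"
proof (rule tendsto_sandwich[of "\<lambda>n. 1 - 1 / real (Suc n)" a sequentially "\<lambda>_. 1"])
  show "(\<lambda>n. 1 - 1 / real (Suc n)) \<longlonglongrightarrow> 1"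
    using tendsto_diff[OF tendsto_const[of 1] LIMSEQ_inverse_real_of_nat]
    by (simp add: inverse_eq_divide)
qed (use assms in auto)

lemma compact_operator_attains_norm:
  fixes T :: "'a::real_normed_vector \<Rightarrow>\<^sub>L 'b::real_normed_vector"
  assumes refl: "reflexive_space TYPE('a)" and kk: "kadets_klee TYPE('a)"
    and compact: "compact_operator T" and T: "norm T = 1"
  obtains x0 where "x0 \<in> norm_attainment_set T"
proof -
  have "\<exists>x. norm x = 1 \<and> norm (T x) > 1 - 1 / real (Suc n)" for n
  proof (rule ccontr)
    assume "\<not> ?thesis"
    \<comment> \<open>The sphere bound requires a nonnegative right-hand side, which
      \<open>Suc n\<close> ensures even for \<open>n = 0\<close>.\<close>
    then have "norm T \<le> 1 - 1 / real (Suc n)"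
      by (intro norm_blinfun_bound_sphere) (auto simp: not_less)
    with T show False by simp
  qed
  then obtain x where x: "\<And>n. norm (x n) = 1" "\<And>n. norm (T (x n)) > 1 - 1 / real (Suc n)"
    by metis
  have "(\<lambda>n. norm (T (x n))) \<longlonglongrightarrow> 1"
    using x(2) norm_blinfun_sphere_le[OF x(1), of T] T
    by (intro one_minus_inverse_Suc_tendsto) (auto simp: less_imp_le)
  with compact_operator_maximizing_sequence[where x = x, OF assms x(1)] show thesis
    using that by blast
qed

text \<open>Otherwise a maximizing sequence stays at distance \<open>e\<close> from
  \<open>x0\<close> and \<open>- x0\<close>, and a subsequence converges to a further point of norm
  attainment.\<close>

lemma compact_operator_strongly_attains:
  fixes T :: "'a::real_normed_vector \<Rightarrow>\<^sub>L 'b::real_normed_vector"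
  assumes refl: "reflexive_space TYPE('a)" and kk: "kadets_klee TYPE('a)"
    and compact: "compact_operator T" and T: "norm T = 1"
    and x0: "x0 \<in> norm_attainment_set T"
    and unique: "\<And>x. x \<in> norm_attainment_set T \<Longrightarrow> x = x0 \<or> x = - x0"
  shows "strongly_attains T x0"
proof -
  have "\<exists>\<delta>>0. \<forall>x. norm x = 1 \<longrightarrow> norm (T x) > 1 - \<delta> \<longrightarrow>
      norm (x - x0) < e \<or> norm (x + x0) < e" if "e > 0" for e
  proof (rule ccontr)
    assume contra: "\<not> ?thesis"
    have "\<exists>x. norm x = 1 \<and> norm (T x) > 1 - 1 / real (Suc n) \<and>
        e \<le> norm (x - x0) \<and> e \<le> norm (x + x0)" for n
    proof -
      have "1 / real (Suc n) > 0" by simp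
      with contra show ?thesis by (meson not_less)
    qed
    then obtain x where x: "\<And>n. norm (x n) = 1" "\<And>n. norm (T (x n)) > 1 - 1 / real (Suc n)"
      "\<And>n. e \<le> norm (x n - x0)" "\<And>n. e \<le> norm (x n + x0)"
      by metis
    have "(\<lambda>n. norm (T (x n))) \<longlonglongrightarrow> 1"
      using x(2) norm_blinfun_sphere_le[OF x(1), of T] T
      by (intro one_minus_inverse_Suc_tendsto) (auto simp: less_imp_le)
    then obtain r l where r: "(x \<circ> r) \<longlonglongrightarrow> l" "l \<in> norm_attainment_set T"
      using compact_operator_maximizing_sequence[where x = x, OF refl kk compact T x(1)] by blast
    have "(\<lambda>n. norm ((x \<circ> r) n - x0)) \<longlonglongrightarrow> norm (l - x0)"
      "(\<lambda>n. norm ((x \<circ> r) n + x0)) \<longlonglongrightarrow> norm (l + x0)"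
      by (intro tendsto_norm tendsto_diff tendsto_add r(1) tendsto_const)+
    then have "e \<le> norm (l - x0)" "e \<le> norm (l + x0)"
      using x(3,4) by (auto intro!: LIMSEQ_le_const simp: o_def)
    with unique[OF r(2)] \<open>e > 0\<close> show False
      by auto
  qed
  moreover have "norm x0 = 1" "norm (T x0) = 1"
    using T x0 by (auto simp: norm_attainment_set_def)
  ultimately show ?thesis
    using T unfolding strongly_attains_def by blast
qed

section \<open>Smooth approximations\<close>

text \<open>The deficit of \<open>T\<close> is at most \<open>c\<close> times that of
  \<open>A\<close>, so the tolerance \<open>\<delta> / c\<close> for \<open>A\<close> gives the
  tolerance \<open>\<delta>\<close> for \<open>T\<close>.\<close>

lemma strongly_attains_transfer:
  fixes T A :: "'a::real_normed_vector \<Rightarrow>\<^sub>L 'b::real_normed_vector"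
  assumes T: "strongly_attains T x0" and A: "norm A = 1" "norm (A x0) = 1"
    and "c > 0" and le: "\<And>x. norm x = 1 \<Longrightarrow> 1 - norm (T x) \<le> c * (1 - norm (A x))"
  shows "strongly_attains A x0"
  unfolding strongly_attains_def
proof (intro conjI allI impI)
  fix r :: real assume "r > 0"
  then obtain \<delta> where \<delta>: "\<delta> > 0" "\<And>x. norm x = 1 \<Longrightarrow> norm (T x) > 1 - \<delta> \<Longrightarrow>
      norm (x - x0) < r \<or> norm (x + x0) < r"
    using T unfolding strongly_attains_def by meson
  have "norm (T x) > 1 - \<delta>" if "norm x = 1" "norm (A x) > 1 - \<delta> / c" for x
  proof -
    have "c * (1 - norm (A x)) < \<delta>"
      using that(2) \<open>c > 0\<close> by (simp add: field_simps)
    with le[OF that(1)] show ?thesis by simp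
  qed
  with \<delta> \<open>c > 0\<close> show "\<exists>\<delta>>0. \<forall>x. norm x = 1 \<longrightarrow> norm (A x) > 1 - \<delta> \<longrightarrow>
      norm (x - x0) < r \<or> norm (x + x0) < r"
    by (intro exI[of _ "\<delta> / c"]) auto
qed (use strongly_attains_norms[OF T] A in auto)

text \<open>Both \<open>x0\<close> and \<open>- x0\<close> lie in
  \<open>norm_attainment_set A\<close>, and strong attainment by \<open>T\<close> places every
  near-maximizer close to one of them.\<close>

lemma strongly_attains_uniform_BPB:
  fixes T A :: "'a::real_normed_vector \<Rightarrow>\<^sub>L 'b::real_normed_vector"
  assumes T: "strongly_attains T x0" and A: "norm A = 1" "norm (A x0) = 1"
    and "norm (T - A) < e"
  shows "uniform_BPB_approximation e T A"
proof -
  have "e > 0"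
    using assms(4) norm_ge_zero le_less_trans by blast
  then obtain \<delta> where \<delta>: "\<delta> > 0" "\<And>x. norm x = 1 \<Longrightarrow> norm (T x) > 1 - \<delta> \<Longrightarrow>
      norm (x - x0) < e \<or> norm (x + x0) < e"
    using T unfolding strongly_attains_def by meson
  have mem: "x0 \<in> norm_attainment_set A" "- x0 \<in> norm_attainment_set A"
    using strongly_attains_norms[OF T] A
    by (auto simp: norm_attainment_set_def blinfun.minus_right)
  have "\<exists>u\<in>norm_attainment_set A. norm (u - x) < e" if x: "norm x = 1" "norm (T x) > 1 - \<delta>" for x
    using \<delta>(2)[OF x]
  proof
    assume "norm (x - x0) < e"
    then show ?thesis
      using mem(1) by (auto simp: norm_minus_commute)
  next
    assume "norm (x + x0) < e"
    then have "norm (- x0 - x) < e"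
      using norm_minus_cancel[of "x + x0"] by (simp add: algebra_simps)
    then show ?thesis
      using mem(2) by auto
  qed
  with \<delta>(1) show ?thesis
    using strongly_attains_norms(1)[OF T] A(1) assms(4)
    unfolding uniform_BPB_approximation_def by blast
qed

section \<open>Construction of the non-trivial approximations\<close>

lemma dim_greater_one_obtain_nonmultiple:
  fixes y :: "'b::real_vector"
  assumes "dim_greater_one TYPE('b)"
  obtains w where "w \<notin> span {y}"
proof -
  obtain B :: "'b set" where B: "independent B" "infinite B \<or> card B > 1"
    using assms by (auto simp: dim_greater_one_def)
  have "\<not> B \<subseteq> span {y}"
  proof
    assume "B \<subseteq> span {y}"
    then have "finite B \<and> card B \<le> card {y}"
      using B(1) by (intro independent_span_bound) auto
    with B(2) show False by simp
  qed
  with that show thesis by blast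
qed

text \<open>Normalize \<open>y + s *\<^sub>R w\<close> for small nonzero \<open>s\<close>, with
  \<open>w\<close> outside the line of \<open>y\<close>; the result is not a multiple of
  \<open>y\<close>.\<close>

lemma nearby_distinct_unit_vector:
  fixes y :: "'b::real_normed_vector"
  assumes dim: "dim_greater_one TYPE('b)" and y: "norm y = 1" and "e > 0"
  obtains z where "norm z = 1" "z \<noteq> y" "norm (z - y) < e"
proof -
  obtain w where w: "w \<notin> span {y}"
    using dim_greater_one_obtain_nonmultiple[OF dim] .
  define v where "v = (\<lambda>s. (y + s *\<^sub>R w) /\<^sub>R norm (y + s *\<^sub>R w))"
  have "(v \<longlongrightarrow> (y + 0 *\<^sub>R w) /\<^sub>R norm (y + 0 *\<^sub>R w)) (at 0)"
    unfolding v_def using y by (intro tendsto_intros) auto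
  then have "(v \<longlongrightarrow> y) (at 0)"
    using y by simp
  then have "\<forall>\<^sub>F s in at 0. dist (v s) y < e"
    using \<open>e > 0\<close> by (rule tendstoD)
  moreover have "\<forall>\<^sub>F s in at (0::real). s \<noteq> 0"
    by (rule eventually_neq_at_within)
  ultimately have "\<forall>\<^sub>F s in at 0. dist (v s) y < e \<and> s \<noteq> 0"
    by eventually_elim simp
  then obtain s where s: "dist (v s) y < e" "s \<noteq> 0"
    using eventually_happens'[OF trivial_limit_at[of "0::real"]] by blast
  have not_multiple: "y + s *\<^sub>R w \<noteq> c *\<^sub>R y" for c
  proof
    assume "y + s *\<^sub>R w = c *\<^sub>R y"
    then have "s *\<^sub>R w = (c - 1) *\<^sub>R y"
      by (simp add: algebra_simps)
    then have "(1 / s) *\<^sub>R s *\<^sub>R w = (1 / s) *\<^sub>R (c - 1) *\<^sub>R y"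
      by simp
    then have "w = ((c - 1) / s) *\<^sub>R y"
      using s(2) by simp
    with w show False
      by (simp add: span_base span_scale)
  qed
  have nz: "y + s *\<^sub>R w \<noteq> 0"
    using not_multiple[of 0] by simp
  have "v s \<noteq> y"
  proof
    assume "v s = y"
    moreover have "y + s *\<^sub>R w = norm (y + s *\<^sub>R w) *\<^sub>R v s"
      using nz by (simp add: v_def)
    ultimately have "y + s *\<^sub>R w = norm (y + s *\<^sub>R w) *\<^sub>R y"
      by simp
    with not_multiple show False by blast
  qed
  moreover have "norm (v s) = 1"
    using nz by (simp add: v_def)
  ultimately show thesis
    using s(1) by (intro that[of "v s"]) (auto simp: dist_norm)
qed

lemma strongly_attains_nontrivial_smooth_approximation:
  fixes T :: "'a::real_normed_vector \<Rightarrow>\<^sub>L 'b::real_normed_vector"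
  assumes smooth: "smooth_space TYPE('b)" and dim: "dim_greater_one TYPE('b)"
    and T: "strongly_attains T x0" and "e > 0"
  obtains A where "nontrivial_uniform_BPB_approximation e T A" "smooth_element A"
proof -
  note n = strongly_attains_norms[OF T]
  obtain f :: "'a \<Rightarrow>\<^sub>L real" where "\<And>x. f x \<le> norm x" "f x0 = norm x0"
    using support_functional[of x0] by metis
  then have f: "norm f = 1" "f x0 = 1"
    using norm_blinfun_eq_one[of f x0] n by force+
  have fx: "\<bar>f x\<bar> \<le> 1" if "norm x = 1" for x
    using norm_blinfun_sphere_le[OF that, of f] f by simp
  have Tx: "norm (T x) \<le> 1" if "norm x = 1" for x
    using norm_blinfun_sphere_le[OF that, of T] n by simp
  \<comment> \<open>Reduces both cases to a candidate \<open>A\<close> that attains norm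
    \<open>1\<close> at the same \<open>x0\<close> and whose deficit controls that of
    \<open>T\<close>; smoothness then transfers.\<close>
  have result: thesis
    if A: "norm A \<le> 1" "norm (A x0) = 1" "norm (T - A) < e" "A \<noteq> T"
      and c: "c > 0" "\<And>x. norm x = 1 \<Longrightarrow> 1 - norm (T x) \<le> c * (1 - norm (A x))"
    for A :: "'a \<Rightarrow>\<^sub>L 'b" and c :: real
  proof (rule \<open>\<And>A. nontrivial_uniform_BPB_approximation e T A \<Longrightarrow> smooth_element A \<Longrightarrow> thesis\<close>)
    have A1: "norm A = 1"
      using A(1,2) norm_blinfun_sphere_le[OF n(2), of A] by simp
    show "nontrivial_uniform_BPB_approximation e T A"
      using strongly_attains_uniform_BPB[OF T A1 A(2,3)] A(4)
      by (simp add: nontrivial_uniform_BPB_approximation_def)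
    have "A x0 \<noteq> 0"
      using A(2) by auto
    then have "smooth_element (A x0)"
      using smooth by (simp add: smooth_space_def)
    with strongly_attains_transfer[OF T A1 A(2) c] show "smooth_element A"
      by (rule strongly_attains_imp_smooth)
  qed
  show thesis
  proof (cases "T = rank_one f (T x0)")
    \<comment> \<open>Mixing \<open>T\<close> with \<open>rank_one f (T x0)\<close> would return
      \<open>T\<close>, so the range vector is moved to \<open>z\<close>. The deficits of both
      operators equal \<open>1 - \<bar>f x\<bar>\<close>, hence \<open>c = 1\<close>.\<close>
    case True
    obtain z where z: "norm z = 1" "z \<noteq> T x0" "norm (z - T x0) < e"
      using nearby_distinct_unit_vector[OF dim n(3) \<open>e > 0\<close>] .
    have "T - rank_one f z = rank_one f (T x0 - z)"
      using True by (intro blinfun_eqI) (metis blinfun.diff_left rank_one_apply scaleR_diff_right)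
    then have "norm (T - rank_one f z) < e"
      using norm_rank_one_le[of f "T x0 - z"] f z(3) by (simp add: norm_minus_commute)
    moreover have "norm (T x) = \<bar>f x\<bar>" for x
      using arg_cong[OF True, of "\<lambda>B. norm (blinfun_apply B x)"] n by simp
    moreover have "rank_one f z x0 \<noteq> T x0"
      using f z by simp
    ultimately show thesis
      using norm_rank_one_le[of f z] z f by (intro result[of "rank_one f z" 1]) auto
  next
    case False
    \<comment> \<open>\<open>t \<le> 1 / 2\<close> yields the deficit constant \<open>2\<close>;
      \<open>t \<le> e / 4\<close> makes the distance \<open>t * norm (T - R)\<close> at most
      \<open>e / 2\<close>.\<close>
    define t where "t = min (1 / 2) (e / 4)"
    have t: "t > 0" "t \<le> 1 / 2" "t \<le> e / 4"
      using \<open>e > 0\<close> by (auto simp: t_def)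
    define R where "R = rank_one f (T x0)"
    have R: "norm R \<le> 1"
      using norm_rank_one_le[of f "T x0"] f n by (simp add: R_def)
    define A where "A = T - t *\<^sub>R (T - R)"
    have Ax: "norm (A x) \<le> (1 - t) * norm (T x) + t" if x: "norm x = 1" for x
    proof -
      have "A x = (1 - t) *\<^sub>R T x + t *\<^sub>R R x"
        by (simp add: A_def blinfun.diff_left blinfun.add_left blinfun.scaleR_left algebra_simps)
      then have "norm (A x) \<le> norm ((1 - t) *\<^sub>R T x) + norm (t *\<^sub>R R x)"
        by (metis norm_triangle_ineq)
      also have "\<dots> = (1 - t) * norm (T x) + t * norm (R x)"
        using t by simp
      also have "\<dots> \<le> (1 - t) * norm (T x) + t"
        using t norm_blinfun_sphere_le[OF x, of R] R by simp
      finally show ?thesis .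
    qed
    show thesis
    proof (rule result[of A 2])
      show "norm A \<le> 1"
      proof (rule norm_blinfun_bound_sphere)
        fix x :: 'a assume x: "norm x = 1"
        have "(1 - t) * norm (T x) \<le> (1 - t) * 1"
          using t Tx[OF x] by (intro mult_left_mono) auto
        with Ax[OF x] show "norm (A x) \<le> 1" by simp
      qed simp
      have "A x0 = T x0"
        using f by (simp add: A_def R_def blinfun.diff_left blinfun.scaleR_left)
      then show "norm (A x0) = 1"
        using n by simp
      have "norm (T - A) = t * norm (T - R)"
        using t by (simp add: A_def)
      also have "\<dots> \<le> t * 2"
        using t norm_triangle_ineq4[of T R] n R by (intro mult_left_mono) auto
      also have "\<dots> < e"
        using t \<open>e > 0\<close> by simp
      finally show "norm (T - A) < e" .
      show "A \<noteq> T"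
        using False t by (simp add: A_def R_def)
      fix x :: 'a assume x: "norm x = 1"
      have "(1 / 2) * (1 - norm (T x)) \<le> (1 - t) * (1 - norm (T x))"
        using t Tx[OF x] by (intro mult_right_mono) auto
      also have "\<dots> \<le> 1 - norm (A x)"
        using Ax[OF x] by (simp add: algebra_simps)
      finally show "1 - norm (T x) \<le> 2 * (1 - norm (A x))"
        by simp
    qed simp
  qed
qed

text \<open>With \<open>e\<close> at most half of both \<open>norm (x - y)\<close> and
  \<open>norm (x + y)\<close>, the points \<open>u\<close> and \<open>v\<close> near
  \<open>x\<close> and \<open>y\<close> at which the smooth \<open>A\<close> attains its norm cannot
  satisfy \<open>v = u\<close> or \<open>v = - u\<close>.\<close>

lemma smooth_approximations_attainment_unique:
  fixes T :: "'a::real_normed_vector \<Rightarrow>\<^sub>L 'b::real_normed_vector"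
  assumes approx: "\<And>e. e > 0 \<Longrightarrow> \<exists>A. uniform_BPB_approximation e T A \<and> smooth_element A"
    and x: "x \<in> norm_attainment_set T" and y: "y \<in> norm_attainment_set T"
  shows "y = x \<or> y = - x"
proof (rule ccontr)
  assume "\<not> ?thesis"
  then have "norm (x - y) > 0" "norm (x + y) > 0"
    by (auto simp: add_eq_0_iff)
  then obtain e where e: "e > 0" "2 * e \<le> norm (x - y)" "2 * e \<le> norm (x + y)"
    by (intro that[of "min (norm (x - y)) (norm (x + y)) / 2"]) auto
  obtain A where A: "uniform_BPB_approximation e T A" "smooth_element A"
    using approx[OF e(1)] by auto
  \<comment> \<open>Here \<open>norm (T z) = 1\<close>, which exceeds \<open>1 - \<delta>\<close>
    for any positive \<open>\<delta>\<close>.\<close>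
  have "\<exists>u\<in>norm_attainment_set A. norm (u - z) < e" if "z \<in> norm_attainment_set T" for z
    using A(1) that by (fastforce simp: uniform_BPB_approximation_def norm_attainment_set_def)
  then obtain u v where uv: "u \<in> norm_attainment_set A" "norm (u - x) < e"
    "v \<in> norm_attainment_set A" "norm (v - y) < e"
    using x y by meson
  from smooth_operator_norm_attainment_unique[OF A(2) uv(1,3)] show False
  proof
    assume "v = u"
    then show False
      using norm_triangle_ineq4[of "u - y" "u - x"] uv e by simp
  next
    assume "v = - u"
    then show False
      using norm_triangle_ineq[of "u - x" "v - y"] uv e norm_minus_cancel[of "x + y"] by simp
  qed
qed

theorem theorem3p23:
  fixes T :: "'a::banach \<Rightarrow>\<^sub>L 'b::banach"
  assumes "reflexive_space TYPE('a)"
    and "kadets_klee TYPE('a)"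
    and "smooth_space TYPE('b)"
    and "dim_greater_one TYPE('b)"
    and "compact_operator T"
    and "norm T = 1"
  shows "smooth_element T \<longleftrightarrow>
    (\<forall>\<epsilon>>0. \<exists>A. nontrivial_uniform_BPB_approximation \<epsilon> T A \<and> smooth_element A)"
proof -
  obtain x0 where x0: "x0 \<in> norm_attainment_set T"
    using compact_operator_attains_norm[OF assms(1,2,5,6)] .
  \<comment> \<open>What remains open in \<open>attains\<close> is that \<open>T\<close> attains its
    norm only at \<open>x0\<close> and \<open>- x0\<close>; each direction of the equivalence
    supplies this in its own way.\<close>
  note attains = compact_operator_strongly_attains[OF assms(1,2,5,6) x0]
  show ?thesis
  proof
    assume "smooth_element T"
    then have "strongly_attains T x0"
      using attains smooth_operator_norm_attainment_unique[OF _ x0] by blast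
    then show "\<forall>\<epsilon>>0. \<exists>A. nontrivial_uniform_BPB_approximation \<epsilon> T A \<and> smooth_element A"
      using strongly_attains_nontrivial_smooth_approximation[OF assms(3,4)] by metis
  next
    assume approx: "\<forall>\<epsilon>>0. \<exists>A. nontrivial_uniform_BPB_approximation \<epsilon> T A \<and> smooth_element A"
    then have "\<exists>A. uniform_BPB_approximation \<epsilon> T A \<and> smooth_element A" if "\<epsilon> > 0" for \<epsilon>
      using that by (auto simp: nontrivial_uniform_BPB_approximation_def)
    then have "strongly_attains T x0"
      using attains smooth_approximations_attainment_unique[OF _ x0] by blast
    moreover have "T x0 \<noteq> 0"
      using assms(6) x0 by (auto simp: norm_attainment_set_def)
    then have "smooth_element (T x0)"
      using assms(3) by (simp add: smooth_space_def)
    ultimately show "smooth_element T"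
      by (rule strongly_attains_imp_smooth)
  qed
qed

end
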